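(* Let $\mathbf{DPG}$ be the category of dynamical post-groups over $\Lambda$ and $\mathbf{DSB}$ the category of dynamical skew braces over $\Lambda$. The assignment $\mathfrak{F}:(\mathscr{G},\{\cdot_\lambda\},\{\vartriangleright_\lambda\})\mapsto(\mathscr{G},\{\cdot_\lambda\},\{\circ_\lambda\})$ with $a\circ_\lambda b=a\cdot_\lambda(a\vartriangleright_\lambda b)$, being the identity on morphisms, is a functor $\mathbf{DPG}\to\mathbf{DSB}$; the assignment $\mathfrak{G}:(\mathscr{G},\{\cdot_\lambda\},\{\circ_\lambda\})\mapsto(\mathscr{G},\{\cdot_\lambda\},\{\vartriangleright_\lambda\})$ with $a\vartriangleright_\lambda b=a^\lambda\cdot_\lambda(a\circ_\lambda b)$, being the identity on morphisms, is a functor $\mathbf{DSB}\to\mathbf{DPG}$. Moreover, $\mathfrak{F}$ and $\mathfrak{G}$ are mutually inverse, giving an isomorphism between the categories $\mathbf{DPG}$ and $\mathbf{DSB}$.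
   Context: Fix a set $\Lambda$. A dynamical set is a triple $\mathscr{X}=(X,\Lambda,\phi_X)$ with $X$ a set and $\phi_X:\Lambda\times X\to\Lambda$ a map. A morphism $\mathscr{X}\to\mathscr{Y}$ is a map $f:\Lambda\times X\to Y$, $f_\lambda=f(\lambda,-)$, with $\phi_Y(\lambda,f_\lambda(x))=\phi_X(\lambda,x)$; composition is $(g\circ f)_\lambda=g_\lambda\circ f_\lambda$. Dynamical group: a dynamical set $\mathscr{G}=(G,\Lambda,\phi_G)$ with maps $\circ_\lambda:G\times G\to G$ such that $\phi_G(\lambda,a\circ_\lambda b)=\phi_G(\phi_G(\lambda,a),b)$ and $a\circ_\lambda(b\circ_{\phi_G(\lambda,a)}c)=(a\circ_\lambda b)\circ_\lambda c$; an element $e_G$ with $a\circ_\lambda e_G=e_G\circ_\lambda a=a$ and $\phi_G(\lambda,e_G)=\lambda$; and for all $\lambda,a$ an element $\bar a^\lambda$ with $a\circ_\lambda\bar a^\lambda=\bar a^\lambda\circ_{\phi_G(\lambda,a)}a=e_G$. A constant dynamical group is a dynamical group whose structure map is $(\lambda,x)\mapsto\lambda$, i.e. a family of group structures $\cdot_\lambda$ ($\lambda\in\Lambda$) on one set with a common unit; $a^\lambda$ denotes the inverse of $a$ for $\cdot_\lambda$. Dynamical post-group (objects of $\mathbf{DPG}$): a dynamical set $\mathscr{G}=(G,\Lambda,\phi_G)$ with maps $\cdot_\lambda,\vartriangleright_\lambda:G\times G\to G$ ($\lambda\in\Lambda$) such that $(G,\Lambda,\{\cdot_\lambda\})$ is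 a constant dynamical group; and for all $\lambda\in\Lambda$, $a,b,c\in G$: $a\vartriangleright_\lambda(b\cdot_{\phi_G(\lambda,a)}c)=(a\vartriangleright_\lambda b)\cdot_\lambda(a\vartriangleright_\lambda c)$; $(a\cdot_\lambda(a\vartriangleright_\lambda b))\vartriangleright_\lambda c=a\vartriangleright_\lambda(b\vartriangleright_{\phi_G(\lambda,a)}c)$; and the map $b\mapsto a\vartriangleright_\lambda b$ is invertible. Morphisms of $\mathbf{DPG}$: morphisms of dynamical sets $\Psi:\mathscr{G}\to\mathscr{H}$ with $\Psi_\lambda(a\cdot_\lambda b)=\Psi_\lambda(a)\cdot'_\lambda\Psi_\lambda(b)$ and $\Psi_\lambda(a\vartriangleright_\lambda b)=\Psi_\lambda(a)\vartriangleright'_\lambda\Psi_{\phi_G(\lambda,a)}(b)$. Dynamical skew brace $(\mathscr{G},\{\cdot_\lambda\},\{\circ_\lambda\})$ (objects of $\mathbf{DSB}$): $(G,\Lambda,\{\cdot_\lambda\})$ is a constant dynamical group, $(\mathscr{G},\{\circ_\lambda\})$ is a dynamical group, and $a\circ_\lambda(b\cdot_{\phi_G(\lambda,a)}c)=(a\circ_\lambda b)\cdot_\lambda a^\lambda\cdot_\lambda(a\circ_\lambda c)$. Morphisms of $\mathbf{DSB}$: morphisms of dynamical sets $\Psi$ with $\Psi_\lambda(a\cdot_\lambda b)=\Psi_\lambda(a)\cdot'_\lambda\Psi_\lambda(b)$ and $\Psi_\lambda(a\circ_\lambda b)=\Psi_\lambda(a)\circ'_\lambda\Psi_{\phi_G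(\lambda,a)}(b)$.
   Formalization: Objects of DPG are also required to satisfy φ(λ,e)=λ and φ(λ,a·_λ(a▷_λ b))=φ(φ(λ,a),b); without this F need not give a skew brace (Z/2, a▷b=b, φ swapping two points), and every post-group whose F-image is a skew brace satisfies it. *)

theory Defs
  imports Main "HOL-Library.FuncSet"
begin

section \<open>Categories and functors\<close>

text \<open>
  Categories are presented by hom-sets.  Hom-sets of different pairs of objects need not be
  disjoint, so composition and the action of a functor on morphisms take the objects concerned as
  arguments: \<open>Comp C X Y Z g f\<close> is the composite of \<open>f : X \<rightarrow> Y\<close> and \<open>g : Y \<rightarrow> Z\<close>.
\<close>

record ('o, 'm) category =
  Obj :: "'o set"
  Hom :: "'o \<Rightarrow> 'o \<Rightarrow> 'm set"
  Ident :: "'o \<Rightarrow> 'm"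
  Comp :: "'o \<Rightarrow> 'o \<Rightarrow> 'o \<Rightarrow> 'm \<Rightarrow> 'm \<Rightarrow> 'm"

definition is_category :: "('o, 'm) category \<Rightarrow> bool" where
  "is_category C \<longleftrightarrow>
     (\<forall>X\<in>Obj C. Ident C X \<in> Hom C X X) \<and>
     (\<forall>X\<in>Obj C. \<forall>Y\<in>Obj C. \<forall>Z\<in>Obj C. \<forall>f\<in>Hom C X Y. \<forall>g\<in>Hom C Y Z.
        Comp C X Y Z g f \<in> Hom C X Z) \<and>
     (\<forall>X\<in>Obj C. \<forall>Y\<in>Obj C. \<forall>f\<in>Hom C X Y.
        Comp C X X Y f (Ident C X) = f \<and> Comp C X Y Y (Ident C Y) f = f) \<and>
     (\<forall>W\<in>Obj C. \<forall>X\<in>Obj C. \<forall>Y\<in>Obj C. \<forall>Z\<in>Obj C.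
        \<forall>f\<in>Hom C W X. \<forall>g\<in>Hom C X Y. \<forall>h\<in>Hom C Y Z.
        Comp C W X Z (Comp C X Y Z h g) f = Comp C W Y Z h (Comp C W X Y g f))"

record ('o, 'm, 'p, 'n) category_map =
  omap :: "'o \<Rightarrow> 'p"
  amap :: "'o \<Rightarrow> 'o \<Rightarrow> 'm \<Rightarrow> 'n"

definition is_functor ::
  "('o, 'm) category \<Rightarrow> ('p, 'n) category \<Rightarrow> ('o, 'm, 'p, 'n) category_map \<Rightarrow> bool" where
  "is_functor C D F \<longleftrightarrow>
     is_category C \<and> is_category D \<and>
     (\<forall>X\<in>Obj C. omap F X \<in> Obj D) \<and>
     (\<forall>X\<in>Obj C. \<forall>Y\<in>Obj C. \<forall>f\<in>Hom C X Y. amap F X Y f \<in> Hom D (omap F X) (omap F Y)) \<and>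
     (\<forall>X\<in>Obj C. amap F X X (Ident C X) = Ident D (omap F X)) \<and>
     (\<forall>X\<in>Obj C. \<forall>Y\<in>Obj C. \<forall>Z\<in>Obj C. \<forall>f\<in>Hom C X Y. \<forall>g\<in>Hom C Y Z.
        amap F X Z (Comp C X Y Z g f)
          = Comp D (omap F X) (omap F Y) (omap F Z) (amap F Y Z g) (amap F X Y f))"

definition id_functor :: "('o, 'm, 'o, 'm) category_map" where
  "id_functor = \<lparr> omap = (\<lambda>X. X), amap = (\<lambda>X Y f. f) \<rparr>"

definition comp_functor ::
  "('p, 'n, 'q, 'k) category_map \<Rightarrow> ('o, 'm, 'p, 'n) category_map
    \<Rightarrow> ('o, 'm, 'q, 'k) category_map" where
  "comp_functor G F =
     \<lparr> omap = (\<lambda>X. omap G (omap F X)),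
       amap = (\<lambda>X Y f. amap G (omap F X) (omap F Y) (amap F X Y f)) \<rparr>"

definition functors_agree ::
  "('o, 'm) category \<Rightarrow> ('o, 'm, 'p, 'n) category_map \<Rightarrow> ('o, 'm, 'p, 'n) category_map \<Rightarrow> bool" where
  "functors_agree C F F' \<longleftrightarrow>
     (\<forall>X\<in>Obj C. omap F X = omap F' X) \<and>
     (\<forall>X\<in>Obj C. \<forall>Y\<in>Obj C. \<forall>f\<in>Hom C X Y. amap F X Y f = amap F' X Y f)"

definition category_isomorphism ::
  "('o, 'm) category \<Rightarrow> ('p, 'n) category \<Rightarrow> ('o, 'm, 'p, 'n) category_map \<Rightarrow> bool" where
  "category_isomorphism C D F \<longleftrightarrow>
     is_functor C D F \<and>
     (\<exists>G. is_functor D C G \<and>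
          functors_agree C (comp_functor G F) id_functor \<and>
          functors_agree D (comp_functor F G) id_functor)"


section \<open>Dynamical sets and dynamical groups\<close>

text \<open>
  The set \<open>\<Lambda>\<close> and the underlying sets are carrier sets.  All structure maps and morphisms are
  curried elements of iterated extensional function spaces \<open>\<rightarrow>\<^sub>E\<close>, i.e. they are \<open>undefined\<close> outside
  the carriers, so that equality in HOL is equality of maps on the carriers.
\<close>

record ('l, 'a) dyn_set =
  Carrier :: "'a set"
  act :: "'l \<Rightarrow> 'a \<Rightarrow> 'l"

definition dynamical_set :: "'l set \<Rightarrow> ('l, 'a, 'z) dyn_set_scheme \<Rightarrow> bool" where
  "dynamical_set \<Lambda> X \<longleftrightarrow> act X \<in> \<Lambda> \<rightarrow>\<^sub>E Carrier X \<rightarrow>\<^sub>E \<Lambda>"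

definition dyn_set_hom ::
  "'l set \<Rightarrow> ('l, 'a, 'z) dyn_set_scheme \<Rightarrow> ('l, 'b, 'y) dyn_set_scheme \<Rightarrow> ('l \<Rightarrow> 'a \<Rightarrow> 'b) set" where
  "dyn_set_hom \<Lambda> X Y =
     {f \<in> \<Lambda> \<rightarrow>\<^sub>E Carrier X \<rightarrow>\<^sub>E Carrier Y. \<forall>l\<in>\<Lambda>. \<forall>x\<in>Carrier X. act Y l (f l x) = act X l x}"

definition dyn_id :: "'l set \<Rightarrow> ('l, 'a, 'z) dyn_set_scheme \<Rightarrow> 'l \<Rightarrow> 'a \<Rightarrow> 'a" where
  "dyn_id \<Lambda> X = (\<lambda>l\<in>\<Lambda>. \<lambda>x\<in>Carrier X. x)"

definition dyn_comp ::
  "'l set \<Rightarrow> ('l, 'a, 'z) dyn_set_scheme \<Rightarrow> ('l \<Rightarrow> 'b \<Rightarrow> 'c) \<Rightarrow> ('l \<Rightarrow> 'a \<Rightarrow> 'b) \<Rightarrow> 'l \<Rightarrow> 'a \<Rightarrow> 'c" where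
  "dyn_comp \<Lambda> X g f = (\<lambda>l\<in>\<Lambda>. \<lambda>x\<in>Carrier X. g l (f l x))"

definition is_dyn_unit ::
  "'l set \<Rightarrow> ('l, 'a, 'z) dyn_set_scheme \<Rightarrow> ('l \<Rightarrow> 'a \<Rightarrow> 'a \<Rightarrow> 'a) \<Rightarrow> 'a \<Rightarrow> bool" where
  "is_dyn_unit \<Lambda> X mul e \<longleftrightarrow>
     e \<in> Carrier X \<and>
     (\<forall>l\<in>\<Lambda>. act X l e = l \<and> (\<forall>a\<in>Carrier X. mul l a e = a \<and> mul l e a = a))"

definition dynamical_group ::
  "'l set \<Rightarrow> ('l, 'a, 'z) dyn_set_scheme \<Rightarrow> ('l \<Rightarrow> 'a \<Rightarrow> 'a \<Rightarrow> 'a) \<Rightarrow> bool" where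
  "dynamical_group \<Lambda> X mul \<longleftrightarrow>
     dynamical_set \<Lambda> X \<and>
     mul \<in> \<Lambda> \<rightarrow>\<^sub>E Carrier X \<rightarrow>\<^sub>E Carrier X \<rightarrow>\<^sub>E Carrier X \<and>
     (\<forall>l\<in>\<Lambda>. \<forall>a\<in>Carrier X. \<forall>b\<in>Carrier X. act X l (mul l a b) = act X (act X l a) b) \<and>
     (\<forall>l\<in>\<Lambda>. \<forall>a\<in>Carrier X. \<forall>b\<in>Carrier X. \<forall>c\<in>Carrier X.
        mul l a (mul (act X l a) b c) = mul l (mul l a b) c) \<and>
     (\<exists>e. is_dyn_unit \<Lambda> X mul e \<and>
        (\<forall>l\<in>\<Lambda>. \<forall>a\<in>Carrier X. \<exists>b\<in>Carrier X. mul l a b = e \<and> mul (act X l a) b a = e))"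

definition const_dyn_set :: "'l set \<Rightarrow> 'a set \<Rightarrow> ('l, 'a) dyn_set" where
  "const_dyn_set \<Lambda> G = \<lparr> Carrier = G, act = (\<lambda>l\<in>\<Lambda>. \<lambda>x\<in>G. l) \<rparr>"

definition constant_dynamical_group ::
  "'l set \<Rightarrow> 'a set \<Rightarrow> ('l \<Rightarrow> 'a \<Rightarrow> 'a \<Rightarrow> 'a) \<Rightarrow> bool" where
  "constant_dynamical_group \<Lambda> G mul \<longleftrightarrow> dynamical_group \<Lambda> (const_dyn_set \<Lambda> G) mul"

text \<open>Unit and inverses \<open>a\<^sup>\<lambda>\<close> of a constant dynamical group; the unit is unique if \<open>\<Lambda> \<noteq> {}\<close>.\<close>

definition const_unit :: "'l set \<Rightarrow> 'a set \<Rightarrow> ('l \<Rightarrow> 'a \<Rightarrow> 'a \<Rightarrow> 'a) \<Rightarrow> 'a" where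
  "const_unit \<Lambda> G mul = (THE e. is_dyn_unit \<Lambda> (const_dyn_set \<Lambda> G) mul e)"

definition const_inv :: "'l set \<Rightarrow> 'a set \<Rightarrow> ('l \<Rightarrow> 'a \<Rightarrow> 'a \<Rightarrow> 'a) \<Rightarrow> 'l \<Rightarrow> 'a \<Rightarrow> 'a" where
  "const_inv \<Lambda> G mul l a =
     (THE b. b \<in> G \<and> mul l a b = const_unit \<Lambda> G mul \<and> mul l b a = const_unit \<Lambda> G mul)"


section \<open>Dynamical post-groups\<close>

record ('l, 'a) dyn_mult = "('l, 'a) dyn_set" +
  dot :: "'l \<Rightarrow> 'a \<Rightarrow> 'a \<Rightarrow> 'a"

record ('l, 'a) dyn_post_group = "('l, 'a) dyn_mult" +
  tri :: "'l \<Rightarrow> 'a \<Rightarrow> 'a \<Rightarrow> 'a"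

definition dynamical_post_group :: "'l set \<Rightarrow> ('l, 'a) dyn_post_group \<Rightarrow> bool" where
  "dynamical_post_group \<Lambda> P \<longleftrightarrow>
     dynamical_set \<Lambda> P \<and>
     constant_dynamical_group \<Lambda> (Carrier P) (dot P) \<and>
     tri P \<in> \<Lambda> \<rightarrow>\<^sub>E Carrier P \<rightarrow>\<^sub>E Carrier P \<rightarrow>\<^sub>E Carrier P \<and>
     (\<forall>l\<in>\<Lambda>. \<forall>a\<in>Carrier P. \<forall>b\<in>Carrier P. \<forall>c\<in>Carrier P.
        tri P l a (dot P (act P l a) b c) = dot P l (tri P l a b) (tri P l a c)) \<and>
     (\<forall>l\<in>\<Lambda>. \<forall>a\<in>Carrier P. \<forall>b\<in>Carrier P. \<forall>c\<in>Carrier P.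
        tri P l (dot P l a (tri P l a b)) c = tri P l a (tri P (act P l a) b c)) \<and>
     (\<forall>l\<in>\<Lambda>. \<forall>a\<in>Carrier P. bij_betw (tri P l a) (Carrier P) (Carrier P))"

text \<open>
  The axioms above do not relate the structure map \<open>act\<close> to the operations, whereas a
  dynamical group requires such relations.  They have to be part of the notion of object of
  \<open>DPG\<close>: \<open>post_group_not_brace\<close> below shows that without them the assignment \<open>F\<close> does not land in
  skew braces, and \<open>action_compatible_necessary\<close> that \<open>action_compatible\<close> demands nothing beyond
  what is needed for \<open>F P\<close> to be a skew brace.
\<close>

definition action_compatible :: "'l set \<Rightarrow> ('l, 'a) dyn_post_group \<Rightarrow> bool" where
  "action_compatible \<Lambda> P \<longleftrightarrow>
     (\<forall>l\<in>\<Lambda>. act P l (const_unit \<Lambda> (Carrier P) (dot P)) = l) \<and>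
     (\<forall>l\<in>\<Lambda>. \<forall>a\<in>Carrier P. \<forall>b\<in>Carrier P.
        act P l (dot P l a (tri P l a b)) = act P (act P l a) b)"

definition post_group_hom ::
  "'l set \<Rightarrow> ('l, 'a) dyn_post_group \<Rightarrow> ('l, 'b) dyn_post_group \<Rightarrow> ('l \<Rightarrow> 'a \<Rightarrow> 'b) set" where
  "post_group_hom \<Lambda> P Q =
     {f \<in> dyn_set_hom \<Lambda> P Q. \<forall>l\<in>\<Lambda>. \<forall>a\<in>Carrier P. \<forall>b\<in>Carrier P.
        f l (dot P l a b) = dot Q l (f l a) (f l b) \<and>
        f l (tri P l a b) = tri Q l (f l a) (f (act P l a) b)}"

text \<open>
  The objects of \<open>DPG \<Lambda>\<close> and \<open>DSB \<Lambda>\<close> are the structures whose underlying set is a subset of the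
  (arbitrary) type \<open>'a\<close>, which plays the role of the universe of sets.
\<close>

definition DPG :: "'l set \<Rightarrow> (('l, 'a) dyn_post_group, 'l \<Rightarrow> 'a \<Rightarrow> 'a) category" where
  "DPG \<Lambda> =
     \<lparr> Obj = {P. dynamical_post_group \<Lambda> P \<and> action_compatible \<Lambda> P},
       Hom = post_group_hom \<Lambda>,
       Ident = dyn_id \<Lambda>,
       Comp = (\<lambda>X Y Z. dyn_comp \<Lambda> X) \<rparr>"


section \<open>Dynamical skew braces\<close>

record ('l, 'a) dyn_skew_brace = "('l, 'a) dyn_mult" +
  circ :: "'l \<Rightarrow> 'a \<Rightarrow> 'a \<Rightarrow> 'a"

definition dynamical_skew_brace :: "'l set \<Rightarrow> ('l, 'a) dyn_skew_brace \<Rightarrow> bool" where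
  "dynamical_skew_brace \<Lambda> B \<longleftrightarrow>
     constant_dynamical_group \<Lambda> (Carrier B) (dot B) \<and>
     dynamical_group \<Lambda> B (circ B) \<and>
     (\<forall>l\<in>\<Lambda>. \<forall>a\<in>Carrier B. \<forall>b\<in>Carrier B. \<forall>c\<in>Carrier B.
        circ B l a (dot B (act B l a) b c) =
        dot B l (dot B l (circ B l a b) (const_inv \<Lambda> (Carrier B) (dot B) l a)) (circ B l a c))"

definition skew_brace_hom ::
  "'l set \<Rightarrow> ('l, 'a) dyn_skew_brace \<Rightarrow> ('l, 'b) dyn_skew_brace \<Rightarrow> ('l \<Rightarrow> 'a \<Rightarrow> 'b) set" where
  "skew_brace_hom \<Lambda> A B =
     {f \<in> dyn_set_hom \<Lambda> A B. \<forall>l\<in>\<Lambda>. \<forall>a\<in>Carrier A. \<forall>b\<in>Carrier A.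
        f l (dot A l a b) = dot B l (f l a) (f l b) \<and>
        f l (circ A l a b) = circ B l (f l a) (f (act A l a) b)}"

definition DSB :: "'l set \<Rightarrow> (('l, 'a) dyn_skew_brace, 'l \<Rightarrow> 'a \<Rightarrow> 'a) category" where
  "DSB \<Lambda> =
     \<lparr> Obj = {B. dynamical_skew_brace \<Lambda> B},
       Hom = skew_brace_hom \<Lambda>,
       Ident = dyn_id \<Lambda>,
       Comp = (\<lambda>X Y Z. dyn_comp \<Lambda> X) \<rparr>"


section \<open>The assignments \<open>F\<close> and \<open>G\<close>\<close>

definition brace_of_post_group ::
  "'l set \<Rightarrow> ('l, 'a) dyn_post_group \<Rightarrow> ('l, 'a) dyn_skew_brace" where
  "brace_of_post_group \<Lambda> P =
     \<lparr> Carrier = Carrier P, act = act P, dot = dot P,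
       circ = (\<lambda>l\<in>\<Lambda>. \<lambda>a\<in>Carrier P. \<lambda>b\<in>Carrier P. dot P l a (tri P l a b)) \<rparr>"

definition post_group_of_brace ::
  "'l set \<Rightarrow> ('l, 'a) dyn_skew_brace \<Rightarrow> ('l, 'a) dyn_post_group" where
  "post_group_of_brace \<Lambda> B =
     \<lparr> Carrier = Carrier B, act = act B, dot = dot B,
       tri = (\<lambda>l\<in>\<Lambda>. \<lambda>a\<in>Carrier B. \<lambda>b\<in>Carrier B.
                dot B l (const_inv \<Lambda> (Carrier B) (dot B) l a) (circ B l a b)) \<rparr>"

definition functor_F ::
  "'l set \<Rightarrow> (('l, 'a) dyn_post_group, 'l \<Rightarrow> 'a \<Rightarrow> 'a, ('l, 'a) dyn_skew_brace, 'l \<Rightarrow> 'a \<Rightarrow> 'a)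
     category_map" where
  "functor_F \<Lambda> = \<lparr> omap = brace_of_post_group \<Lambda>, amap = (\<lambda>P Q f. f) \<rparr>"

definition functor_G ::
  "'l set \<Rightarrow> (('l, 'a) dyn_skew_brace, 'l \<Rightarrow> 'a \<Rightarrow> 'a, ('l, 'a) dyn_post_group, 'l \<Rightarrow> 'a \<Rightarrow> 'a)
     category_map" where
  "functor_G \<Lambda> = \<lparr> omap = post_group_of_brace \<Lambda>, amap = (\<lambda>A B f. f) \<rparr>"


section \<open>On the compatibility condition\<close>

text \<open>The group of order two, acting trivially on itself, with a structure map that swaps two points.\<close>

lemma post_group_not_brace:
  fixes P :: "(bool, bool) dyn_post_group"
  defines "P \<equiv> \<lparr> Carrier = UNIV, act = (\<lambda>l a. \<not> l), dot = (\<lambda>l a b. a \<noteq> b), tri = (\<lambda>l a b. b) \<rparr>"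
  shows "dynamical_post_group UNIV P" "\<not> dynamical_skew_brace UNIV (brace_of_post_group UNIV P)"
proof -
  have "is_dyn_unit UNIV (const_dyn_set (UNIV :: bool set) UNIV) (\<lambda>l a b. a \<noteq> b) False"
    by (simp add: is_dyn_unit_def const_dyn_set_def)
  then have "constant_dynamical_group (UNIV :: bool set) UNIV (\<lambda>l (a::bool) b. a \<noteq> b)"
    unfolding constant_dynamical_group_def dynamical_group_def dynamical_set_def
    by (intro conjI exI[of _ False]) (auto simp: const_dyn_set_def)
  then show "dynamical_post_group UNIV P"
    by (auto simp: dynamical_post_group_def dynamical_set_def P_def bij_betw_def inj_on_def)
  show "\<not> dynamical_skew_brace UNIV (brace_of_post_group UNIV P)"
    by (auto simp: dynamical_skew_brace_def dynamical_group_def is_dyn_unit_def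
        brace_of_post_group_def P_def)
qed

lemma action_compatible_necessary:
  assumes P: "dynamical_post_group \<Lambda> P"
    and B: "dynamical_skew_brace \<Lambda> (brace_of_post_group \<Lambda> P)"
  shows "action_compatible \<Lambda> P"
proof -
  let ?G = "Carrier P" and ?B = "brace_of_post_group \<Lambda> P"
  have act: "act P l a \<in> \<Lambda>" if "l \<in> \<Lambda>" "a \<in> ?G" for l a
    using P that unfolding dynamical_post_group_def dynamical_set_def
    by (meson PiE_mem)
  have tri: "tri P l a b \<in> ?G" if "l \<in> \<Lambda>" "a \<in> ?G" "b \<in> ?G" for l a b
  proof -
    have "tri P \<in> \<Lambda> \<rightarrow>\<^sub>E ?G \<rightarrow>\<^sub>E ?G \<rightarrow>\<^sub>E ?G"
      using P unfolding dynamical_post_group_def by blast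
    then show ?thesis using that by (meson PiE_mem)
  qed
  obtain e where e: "e \<in> ?G" "is_dyn_unit \<Lambda> (const_dyn_set \<Lambda> ?G) (dot P) e"
    and inv: "\<And>l a. l \<in> \<Lambda> \<Longrightarrow> a \<in> ?G \<Longrightarrow> \<exists>b\<in>?G. dot P l a b = e \<and> dot P l b a = e"
    and assoc: "\<And>l a b c. l \<in> \<Lambda> \<Longrightarrow> a \<in> ?G \<Longrightarrow> b \<in> ?G \<Longrightarrow> c \<in> ?G \<Longrightarrow>
        dot P l a (dot P l b c) = dot P l (dot P l a b) c"
    using P unfolding dynamical_post_group_def constant_dynamical_group_def dynamical_group_def
    by (auto simp: is_dyn_unit_def const_dyn_set_def)
  have unit: "dot P l a e = a" "dot P l e a = a" if "l \<in> \<Lambda>" "a \<in> ?G" for l a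
    using e that by (auto simp: is_dyn_unit_def const_dyn_set_def)
  have idem: "a = e" if l: "l \<in> \<Lambda>" and a: "a \<in> ?G" and "dot P l a a = a" for l a
    using inv[OF l a] assoc[OF l _ a a] unit[OF l a] that(3) by metis
  obtain u where u: "u \<in> ?G" "\<And>l. l \<in> \<Lambda> \<Longrightarrow> act P l u = l"
      "\<And>l a. l \<in> \<Lambda> \<Longrightarrow> a \<in> ?G \<Longrightarrow> dot P l a (tri P l a u) = a"
    and actm: "\<And>l a b. l \<in> \<Lambda> \<Longrightarrow> a \<in> ?G \<Longrightarrow> b \<in> ?G \<Longrightarrow>
      act P l (dot P l a (tri P l a b)) = act P (act P l a) b"
    using B unfolding dynamical_skew_brace_def dynamical_group_def is_dyn_unit_def
    by (auto simp: brace_of_post_group_def)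
  have "u = e \<and> const_unit \<Lambda> ?G (dot P) = e" if l: "l \<in> \<Lambda>" for l
  proof
    have "dot P (act P l e) e e = e" using unit act l e by blast
    then have "dot P l (tri P l e e) (tri P l e e) = tri P l e e"
      using P l e(1) unfolding dynamical_post_group_def by metis
    then have "tri P l e e = e" using idem l tri e(1) by blast
    moreover have "tri P l e u = e" using u(3)[OF l e(1)] unit(2)[OF l] tri l e(1) u(1) by metis
    moreover have "inj_on (tri P l e) ?G"
      using P l e(1) unfolding dynamical_post_group_def bij_betw_def by blast
    ultimately show "u = e" using e(1) u(1) by (metis inj_onD)
    show "const_unit \<Lambda> ?G (dot P) = e"
      unfolding const_unit_def
    proof (rule the_equality)
      show "is_dyn_unit \<Lambda> (const_dyn_set \<Lambda> ?G) (dot P) e" by (fact e(2))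
      show "x = e" if "is_dyn_unit \<Lambda> (const_dyn_set \<Lambda> ?G) (dot P) x" for x
        using that unit l e(1) unfolding is_dyn_unit_def const_dyn_set_def by (metis dyn_set.select_convs(1))
    qed
  qed
  then show ?thesis
    using u(2) actm unfolding action_compatible_def by metis
qed

end

(* Both directions rest on the identities a \<circ> b = a \<cdot> (a \<rhd> b) and a \<rhd> b = a\<^sup>\<lambda> \<cdot> (a \<circ> b), so that
   a \<rhd> _ and a \<circ> _ differ by a translation of the group at \<lambda>.  For a post-group, \<rhd> fixes the unit
   and the unit acts as the identity, whence the axioms of \<circ>; a right inverse for \<circ> is
   automatically two-sided.  For a skew brace, the units of \<cdot> and \<circ> coincide, and the brace axiom for
   b \<cdot> b\<^sup>\<phi> = e (inverse at \<phi>(\<lambda>,a)) expresses the inverse of a \<circ> b through a \<circ> b\<^sup>\<phi>, which is what the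
   weighted associativity of \<rhd> needs.  Morphisms of one structure are morphisms of the
   other because they preserve inverses. *)

theory Submission
  imports Defs
begin

section \<open>Equality and membership in iterated extensional function spaces\<close>

lemma PiE2_eqI:
  assumes "f \<in> A \<rightarrow>\<^sub>E B \<rightarrow>\<^sub>E C" "g \<in> A \<rightarrow>\<^sub>E B \<rightarrow>\<^sub>E C"
    and "\<And>x y. x \<in> A \<Longrightarrow> y \<in> B \<Longrightarrow> f x y = g x y"
  shows "f = g"
proof (rule PiE_ext[OF assms(1,2)])
  fix x assume x: "x \<in> A"
  show "f x = g x"
    by (rule PiE_ext[OF PiE_mem[OF assms(1) x] PiE_mem[OF assms(2) x]]) (use assms(3) x in blast)
qed

text \<open>Structure maps are \<open>undefined\<close> off the carriers, so agreement on the
  carriers is equality in HOL. This is what makes the round trips between post-groups and skew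
  braces return literally the same record.\<close>

lemma PiE3_eqI:
  assumes "f \<in> A \<rightarrow>\<^sub>E B \<rightarrow>\<^sub>E C \<rightarrow>\<^sub>E D" "g \<in> A \<rightarrow>\<^sub>E B \<rightarrow>\<^sub>E C \<rightarrow>\<^sub>E D"
    and "\<And>x y z. x \<in> A \<Longrightarrow> y \<in> B \<Longrightarrow> z \<in> C \<Longrightarrow> f x y z = g x y z"
  shows "f = g"
proof (rule PiE_ext[OF assms(1,2)])
  fix x assume x: "x \<in> A"
  show "f x = g x"
    by (rule PiE2_eqI[OF PiE_mem[OF assms(1) x] PiE_mem[OF assms(2) x]]) (use assms(3) x in blast)
qed

lemma PiE2_mem: "f \<in> A \<rightarrow>\<^sub>E B \<rightarrow>\<^sub>E C \<Longrightarrow> x \<in> A \<Longrightarrow> y \<in> B \<Longrightarrow> f x y \<in> C"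
  by (meson PiE_mem)

lemma PiE3_mem: "f \<in> A \<rightarrow>\<^sub>E B \<rightarrow>\<^sub>E C \<rightarrow>\<^sub>E D \<Longrightarrow> x \<in> A \<Longrightarrow> y \<in> B \<Longrightarrow> z \<in> C \<Longrightarrow> f x y z \<in> D"
  by (meson PiE_mem)

section \<open>Constant dynamical groups\<close>

locale group_family =
  fixes \<Lambda> :: "'l set" and G :: "'a set" and mul :: "'l \<Rightarrow> 'a \<Rightarrow> 'a \<Rightarrow> 'a"
  assumes constant_dynamical_group: "constant_dynamical_group \<Lambda> G mul"
begin

abbreviation unit :: 'a where
  "unit \<equiv> const_unit \<Lambda> G mul"

abbreviation inver :: "'l \<Rightarrow> 'a \<Rightarrow> 'a" where
  "inver \<equiv> const_inv \<Lambda> G mul"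

lemma mul_closed [simp]: "l \<in> \<Lambda> \<Longrightarrow> a \<in> G \<Longrightarrow> b \<in> G \<Longrightarrow> mul l a b \<in> G"
  using constant_dynamical_group PiE3_mem[of mul \<Lambda> G G G]
  by (auto simp: constant_dynamical_group_def dynamical_group_def const_dyn_set_def)

lemma assoc:
  "l \<in> \<Lambda> \<Longrightarrow> a \<in> G \<Longrightarrow> b \<in> G \<Longrightarrow> c \<in> G \<Longrightarrow> mul l (mul l a b) c = mul l a (mul l b c)"
  using constant_dynamical_group
  by (auto simp: constant_dynamical_group_def dynamical_group_def const_dyn_set_def)

text \<open>Identifies the existential unit of the group axioms with the definite description
  \<open>const_unit\<close>. The identification is guarded by \<open>l \<in> \<Lambda>\<close>: over
  an empty \<open>\<Lambda>\<close> every element of \<open>G\<close> satisfies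
  \<open>is_dyn_unit\<close>, so the description need not single out \<open>e\<close>.\<close>

lemma obtain_unit:
  obtains e where "e \<in> G" "\<And>l a. l \<in> \<Lambda> \<Longrightarrow> a \<in> G \<Longrightarrow> mul l a e = a \<and> mul l e a = a"
    "\<And>l a. l \<in> \<Lambda> \<Longrightarrow> a \<in> G \<Longrightarrow> \<exists>b\<in>G. mul l a b = e \<and> mul l b a = e"
    "\<And>l. l \<in> \<Lambda> \<Longrightarrow> unit = e"
proof -
  obtain e where e: "is_dyn_unit \<Lambda> (const_dyn_set \<Lambda> G) mul e"
    and i: "\<And>l a. l \<in> \<Lambda> \<Longrightarrow> a \<in> G \<Longrightarrow> \<exists>b\<in>G. mul l a b = e \<and> mul l b a = e"
    using constant_dynamical_group
    by (auto simp: constant_dynamical_group_def dynamical_group_def const_dyn_set_def)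
  have u: "unit = e" if l: "l \<in> \<Lambda>" for l
    unfolding const_unit_def
  proof (rule the_equality)
    show "is_dyn_unit \<Lambda> (const_dyn_set \<Lambda> G) mul e" by (fact e)
  next
    fix x assume "is_dyn_unit \<Lambda> (const_dyn_set \<Lambda> G) mul x"
    then show "x = e"
      using e l unfolding is_dyn_unit_def const_dyn_set_def by (metis dyn_set.select_convs(1))
  qed
  show thesis
    by (rule that[of e]) (use e i u in \<open>auto simp: is_dyn_unit_def const_dyn_set_def\<close>)
qed

lemma unit_closed [simp]: "l \<in> \<Lambda> \<Longrightarrow> unit \<in> G"
  by (metis obtain_unit)

lemma mul_unit [simp]:
  assumes "l \<in> \<Lambda>" "a \<in> G"
  shows "mul l a unit = a" "mul l unit a = a"
  using obtain_unit assms by metis+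

text \<open>Justifies the definite description \<open>const_inv\<close>: two-sided inverses exist,
  and the usual computation \<open>c = (b a) c = b (a c) = b\<close> gives uniqueness.\<close>

lemma inver:
  assumes l: "l \<in> \<Lambda>" and a: "a \<in> G"
  shows "inver l a \<in> G \<and> mul l a (inver l a) = unit \<and> mul l (inver l a) a = unit"
  unfolding const_inv_def
proof (rule theI')
  obtain b where b: "b \<in> G" "mul l a b = unit" "mul l b a = unit"
    using obtain_unit l a by metis
  show "\<exists>!b. b \<in> G \<and> mul l a b = unit \<and> mul l b a = unit"
  proof (rule ex1I[of _ b])
    fix c assume c: "c \<in> G \<and> mul l a c = unit \<and> mul l c a = unit"
    then have "c = mul l (mul l b a) c" using l b by simp
    then show "c = b" using assoc[OF l b(1) a, of c] c b l by simp
  qed (use b in simp)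
qed

lemma inver_closed [simp]: "l \<in> \<Lambda> \<Longrightarrow> a \<in> G \<Longrightarrow> inver l a \<in> G"
  and mul_inver [simp]: "l \<in> \<Lambda> \<Longrightarrow> a \<in> G \<Longrightarrow> mul l a (inver l a) = unit"
  and inver_mul [simp]: "l \<in> \<Lambda> \<Longrightarrow> a \<in> G \<Longrightarrow> mul l (inver l a) a = unit"
  using inver by auto

lemma mul_inver_cancel [simp]:
  assumes "l \<in> \<Lambda>" "a \<in> G" "b \<in> G"
  shows "mul l a (mul l (inver l a) b) = b" "mul l (inver l a) (mul l a b) = b"
  using assms by (simp_all flip: assoc)

lemma mul_left_cancel:
  assumes "l \<in> \<Lambda>" "a \<in> G" "b \<in> G" "c \<in> G" "mul l a b = mul l a c"
  shows "b = c"
  using mul_inver_cancel(2) assms by metis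

lemma idempotent_unit: "l \<in> \<Lambda> \<Longrightarrow> a \<in> G \<Longrightarrow> mul l a a = a \<Longrightarrow> a = unit"
  using mul_left_cancel[of l a a unit] by simp

lemma inver_unique:
  assumes "l \<in> \<Lambda>" "a \<in> G" "b \<in> G" "mul l a b = unit"
  shows "b = inver l a"
  using mul_left_cancel[of l a b "inver l a"] assms by simp

lemma inver_unit [simp]: "l \<in> \<Lambda> \<Longrightarrow> inver l unit = unit"
  using inver_unique[of l unit unit] by simp

end

text \<open>The image of the unit is idempotent, hence the unit, and inverses are unique. The index
  \<open>l\<close> is fixed, so that \<open>f\<close> can be a single component of a dynamical
  morphism.\<close>

lemma group_family_hom_inver:
  assumes "group_family \<Lambda> G mul" "group_family \<Lambda> H mul'"
    and l: "l \<in> \<Lambda>" and a: "a \<in> G"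
    and f: "\<And>x. x \<in> G \<Longrightarrow> f x \<in> H" "\<And>x y. x \<in> G \<Longrightarrow> y \<in> G \<Longrightarrow> f (mul l x y) = mul' l (f x) (f y)"
  shows "f (const_inv \<Lambda> G mul l a) = const_inv \<Lambda> H mul' l (f a)"
proof -
  interpret G: group_family \<Lambda> G mul by fact
  interpret H: group_family \<Lambda> H mul' by fact
  have "mul' l (f G.unit) (f G.unit) = f G.unit"
    using f(2)[of G.unit G.unit] l by simp
  then have "f G.unit = H.unit"
    using l f(1) by (intro H.idempotent_unit[of l]) auto
  then have "mul' l (f a) (f (G.inver l a)) = H.unit"
    using f(2)[of a "G.inver l a"] l a by simp
  then show ?thesis
    using l a f(1) by (intro H.inver_unique) auto
qed

section \<open>From post-groups to skew braces\<close>

locale post_group =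
  fixes \<Lambda> :: "'l set" and P :: "('l, 'a) dyn_post_group"
  assumes post: "dynamical_post_group \<Lambda> P" and compatible: "action_compatible \<Lambda> P"
begin

sublocale group_family \<Lambda> "Carrier P" "dot P"
  using post by unfold_locales (simp add: dynamical_post_group_def)

lemma act_closed [simp]: "l \<in> \<Lambda> \<Longrightarrow> a \<in> Carrier P \<Longrightarrow> act P l a \<in> \<Lambda>"
  using post PiE2_mem[of "act P"] by (auto simp: dynamical_post_group_def dynamical_set_def)

lemma tri_mem: "tri P \<in> \<Lambda> \<rightarrow>\<^sub>E Carrier P \<rightarrow>\<^sub>E Carrier P \<rightarrow>\<^sub>E Carrier P"
  using post by (simp add: dynamical_post_group_def)

lemma tri_closed [simp]:
  "l \<in> \<Lambda> \<Longrightarrow> a \<in> Carrier P \<Longrightarrow> b \<in> Carrier P \<Longrightarrow> tri P l a b \<in> Carrier P"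
  using PiE3_mem[OF tri_mem] .

lemma act_unit [simp]: "l \<in> \<Lambda> \<Longrightarrow> act P l unit = l"
  and act_mul_tri: "l \<in> \<Lambda> \<Longrightarrow> a \<in> Carrier P \<Longrightarrow> b \<in> Carrier P \<Longrightarrow>
    act P l (dot P l a (tri P l a b)) = act P (act P l a) b"
  using compatible by (auto simp: action_compatible_def)

lemma tri_mul: "l \<in> \<Lambda> \<Longrightarrow> a \<in> Carrier P \<Longrightarrow> b \<in> Carrier P \<Longrightarrow> c \<in> Carrier P \<Longrightarrow>
    tri P l a (dot P (act P l a) b c) = dot P l (tri P l a b) (tri P l a c)"
  and mul_tri: "l \<in> \<Lambda> \<Longrightarrow> a \<in> Carrier P \<Longrightarrow> b \<in> Carrier P \<Longrightarrow> c \<in> Carrier P \<Longrightarrow>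
    tri P l (dot P l a (tri P l a b)) c = tri P l a (tri P (act P l a) b c)"
  and tri_bij: "l \<in> \<Lambda> \<Longrightarrow> a \<in> Carrier P \<Longrightarrow> bij_betw (tri P l a) (Carrier P) (Carrier P)"
  using post by (auto simp: dynamical_post_group_def)

text \<open>Distributivity applied to \<open>unit = unit \<cdot> unit\<close> makes the image
  idempotent.\<close>

lemma tri_unit [simp]:
  assumes "l \<in> \<Lambda>" "a \<in> Carrier P"
  shows "tri P l a unit = unit"
  using tri_mul[of l a unit unit] assms by (intro idempotent_unit[of l]) auto

text \<open>Weighted associativity at \<open>a = b = unit\<close> collapses, by
  \<open>act_unit\<close> and \<open>tri_unit\<close>, to idempotence of
  \<open>tri P l unit\<close>; an injective idempotent map is the identity.\<close>

lemma unit_tri [simp]: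
  assumes "l \<in> \<Lambda>" "c \<in> Carrier P"
  shows "tri P l unit c = c"
proof -
  have "tri P l unit (tri P l unit c) = tri P l unit c"
    using mul_tri[of l unit unit c] assms by simp
  moreover have "inj_on (tri P l unit) (Carrier P)"
    using tri_bij[of l unit] assms by (simp add: bij_betw_def)
  ultimately show ?thesis
    using assms by (auto dest: inj_onD)
qed

text \<open>Associativity of \<open>\<circ>\<close> written out in terms of \<open>dot\<close> and
  \<open>tri\<close>: distribute \<open>tri P l a\<close> over the product, then apply weighted
  associativity to the last factor.\<close>

lemma mul_tri_assoc:
  assumes "l \<in> \<Lambda>" "a \<in> Carrier P" "b \<in> Carrier P" "c \<in> Carrier P"
  defines "ab \<equiv> dot P l a (tri P l a b)"
  shows "dot P l a (tri P l a (dot P (act P l a) b (tri P (act P l a) b c))) =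
    dot P l ab (tri P l ab c)"
  using assms by (simp add: ab_def tri_mul mul_tri assoc)

text \<open>The witness is the preimage of the group inverse \<open>inver l a\<close> under the
  bijection \<open>tri P l a\<close>.\<close>

lemma right_inverse:
  assumes "l \<in> \<Lambda>" "a \<in> Carrier P"
  obtains b where "b \<in> Carrier P" "dot P l a (tri P l a b) = unit"
proof -
  have "inver l a \<in> tri P l a ` Carrier P"
    using tri_bij[of l a] assms by (simp add: bij_betw_def)
  then show thesis
    using that assms by (metis imageE mul_inver)
qed

lemma two_sided_inverse:
  assumes l: "l \<in> \<Lambda>" and a: "a \<in> Carrier P"
  shows "\<exists>b\<in>Carrier P. dot P l a (tri P l a b) = unit \<and>
    dot P (act P l a) b (tri P (act P l a) b a) = unit"
proof -
  obtain b where b: "b \<in> Carrier P" "dot P l a (tri P l a b) = unit"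
    using right_inverse[OF l a] .
  obtain c where c: "c \<in> Carrier P" "dot P (act P l a) b (tri P (act P l a) b c) = unit"
    using right_inverse[of "act P l a" b] l a b by auto
  \<comment> \<open>The monoid argument
    \<open>a = a \<circ> (b \<circ> c) = (a \<circ> b) \<circ> c = c\<close>, where \<open>c\<close>
    is a right inverse of \<open>b\<close> over the shifted index \<open>act P l a\<close>.\<close>
  have "a = c"
    using mul_tri_assoc[OF l a b(1) c(1)] l a b c by simp
  then show ?thesis
    using b c by blast
qed

lemma circ_mul:
  assumes "l \<in> \<Lambda>" "a \<in> Carrier P" "b \<in> Carrier P" "c \<in> Carrier P"
  shows "dot P l a (tri P l a (dot P (act P l a) b c)) =
    dot P l (dot P l (dot P l a (tri P l a b)) (inver l a)) (dot P l a (tri P l a c))"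
  using assms by (simp add: tri_mul assoc)

lemma skew_brace: "dynamical_skew_brace \<Lambda> (brace_of_post_group \<Lambda> P)"
proof -
  let ?B = "brace_of_post_group \<Lambda> P"
  have sel: "Carrier ?B = Carrier P" "act ?B = act P" "dot ?B = dot P"
    by (simp_all add: brace_of_post_group_def)
  have circ: "circ ?B l a b = dot P l a (tri P l a b)"
    if "l \<in> \<Lambda>" "a \<in> Carrier P" "b \<in> Carrier P" for l a b
    using that by (simp add: brace_of_post_group_def)
  have circ_mem: "circ ?B \<in> \<Lambda> \<rightarrow>\<^sub>E Carrier P \<rightarrow>\<^sub>E Carrier P \<rightarrow>\<^sub>E Carrier P"
    by (auto simp: brace_of_post_group_def)
  \<comment> \<open>A dynamical group needs a unit in the carrier even when \<open>\<Lambda>\<close>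
    is empty, where \<open>unit_closed\<close> gives nothing; hence a separate \<open>e\<close>,
    equal to \<open>unit\<close> over each \<open>l \<in> \<Lambda>\<close>.\<close>
  obtain e where e: "e \<in> Carrier P" "\<And>l. l \<in> \<Lambda> \<Longrightarrow> e = unit"
    using obtain_unit by metis
  have inv: "\<exists>b\<in>Carrier P. circ ?B l a b = e \<and> circ ?B (act P l a) b a = e"
    if "l \<in> \<Lambda>" "a \<in> Carrier P" for l a
    using two_sided_inverse[OF that] that circ e(2) act_closed by metis
  have un: "is_dyn_unit \<Lambda> ?B (circ ?B) e"
    using e by (auto simp: is_dyn_unit_def sel circ)
  have "dynamical_set \<Lambda> ?B"
    using post by (simp add: dynamical_post_group_def dynamical_set_def sel)
  moreover have "circ ?B l a (circ ?B (act P l a) b c) = circ ?B l (circ ?B l a b) c"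
    if "l \<in> \<Lambda>" "a \<in> Carrier P" "b \<in> Carrier P" "c \<in> Carrier P" for l a b c
    using that mul_tri_assoc by (simp add: circ)
  ultimately have "dynamical_group \<Lambda> ?B (circ ?B)"
    unfolding dynamical_group_def sel using un inv circ_mem
    by (intro conjI exI[of _ e]) (auto simp: circ act_mul_tri)
  then show ?thesis
    unfolding dynamical_skew_brace_def sel
    using constant_dynamical_group circ_mul by (auto simp: circ)
qed

lemma post_group_of_brace_of_post_group: "post_group_of_brace \<Lambda> (brace_of_post_group \<Lambda> P) = P"
proof -
  have "tri (post_group_of_brace \<Lambda> (brace_of_post_group \<Lambda> P)) = tri P"
    by (rule PiE3_eqI[OF _ tri_mem])
      (auto simp: post_group_of_brace_def brace_of_post_group_def)
  then show ?thesis
    by (intro dyn_post_group.equality) (simp_all add: post_group_of_brace_def brace_of_post_group_def)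
qed

end

section \<open>From skew braces to post-groups\<close>

locale skew_brace =
  fixes \<Lambda> :: "'l set" and B :: "('l, 'a) dyn_skew_brace"
  assumes brace: "dynamical_skew_brace \<Lambda> B"
begin

sublocale group_family \<Lambda> "Carrier B" "dot B"
  using brace by unfold_locales (simp add: dynamical_skew_brace_def)

lemma act_closed [simp]: "l \<in> \<Lambda> \<Longrightarrow> a \<in> Carrier B \<Longrightarrow> act B l a \<in> \<Lambda>"
  using brace PiE2_mem[of "act B"]
  by (auto simp: dynamical_skew_brace_def dynamical_group_def dynamical_set_def)

lemma circ_mem: "circ B \<in> \<Lambda> \<rightarrow>\<^sub>E Carrier B \<rightarrow>\<^sub>E Carrier B \<rightarrow>\<^sub>E Carrier B"
  using brace by (simp add: dynamical_skew_brace_def dynamical_group_def)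

lemma circ_closed [simp]:
  "l \<in> \<Lambda> \<Longrightarrow> a \<in> Carrier B \<Longrightarrow> b \<in> Carrier B \<Longrightarrow> circ B l a b \<in> Carrier B"
  using PiE3_mem[OF circ_mem] .

lemma act_circ: "l \<in> \<Lambda> \<Longrightarrow> a \<in> Carrier B \<Longrightarrow> b \<in> Carrier B \<Longrightarrow>
    act B l (circ B l a b) = act B (act B l a) b"
  and circ_assoc: "l \<in> \<Lambda> \<Longrightarrow> a \<in> Carrier B \<Longrightarrow> b \<in> Carrier B \<Longrightarrow> c \<in> Carrier B \<Longrightarrow>
    circ B l (circ B l a b) c = circ B l a (circ B (act B l a) b c)"
  and circ_mul: "l \<in> \<Lambda> \<Longrightarrow> a \<in> Carrier B \<Longrightarrow> b \<in> Carrier B \<Longrightarrow> c \<in> Carrier B \<Longrightarrow>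
    circ B l a (dot B (act B l a) b c) = dot B l (circ B l a b) (dot B l (inver l a) (circ B l a c))"
  using brace by (auto simp: dynamical_skew_brace_def dynamical_group_def assoc)

text \<open>The unit \<open>u\<close> of \<open>\<circ>\<close> is shown to be the unit of
  \<open>\<cdot>\<close>, after which the unit and inverse axioms of \<open>\<circ>\<close> can be
  restated with \<open>unit\<close>.\<close>

lemma circ_unit_inverse:
  assumes l: "l \<in> \<Lambda>"
  shows "act B l unit = l \<and> (\<forall>a\<in>Carrier B. circ B l a unit = a \<and> circ B l unit a = a \<and>
    (\<exists>b\<in>Carrier B. circ B l a b = unit \<and> circ B (act B l a) b a = unit))"
proof -
  obtain u where u: "u \<in> Carrier B" "act B l u = l"
      "\<And>a. a \<in> Carrier B \<Longrightarrow> circ B l a u = a" "\<And>a. a \<in> Carrier B \<Longrightarrow> circ B l u a = a"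
    and i: "\<And>a. a \<in> Carrier B \<Longrightarrow> \<exists>b\<in>Carrier B. circ B l a b = u \<and> circ B (act B l a) b a = u"
    using brace l unfolding dynamical_skew_brace_def dynamical_group_def is_dyn_unit_def by metis
  \<comment> \<open>Since \<open>act B l u = l\<close> and \<open>u \<circ> unit = unit\<close>, the
    brace axiom for \<open>u \<circ> (unit \<cdot> unit)\<close> reads
    \<open>unit = unit \<cdot> (inver l u \<cdot> unit)\<close>.\<close>
  have "inver l u = unit"
    using circ_mul[of l u unit unit] u l by simp
  then have "u = unit"
    using mul_inver[OF l u(1)] u(1) l by simp
  then show ?thesis
    using u i by auto
qed

lemma act_unit [simp]: "l \<in> \<Lambda> \<Longrightarrow> act B l unit = l"
  and circ_unit [simp]: "l \<in> \<Lambda> \<Longrightarrow> a \<in> Carrier B \<Longrightarrow> circ B l a unit = a"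
  and unit_circ [simp]: "l \<in> \<Lambda> \<Longrightarrow> a \<in> Carrier B \<Longrightarrow> circ B l unit a = a"
  and circ_inverse: "l \<in> \<Lambda> \<Longrightarrow> a \<in> Carrier B \<Longrightarrow>
    \<exists>b\<in>Carrier B. circ B l a b = unit \<and> circ B (act B l a) b a = unit"
  using circ_unit_inverse by auto

text \<open>The inverse map is the left \<open>\<circ>\<close>-translation by the inverse
  \<open>b\<close> of \<open>a\<close>, taken over the index \<open>act B l a\<close>.\<close>

lemma circ_bij:
  assumes l: "l \<in> \<Lambda>" and a: "a \<in> Carrier B"
  shows "bij_betw (circ B l a) (Carrier B) (Carrier B)"
proof -
  obtain b where b: "b \<in> Carrier B" "circ B l a b = unit" "circ B (act B l a) b a = unit"
    using circ_inverse[OF l a] by blast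
  \<comment> \<open>Acting by \<open>a\<close> and then by \<open>b\<close> is acting by
    \<open>a \<circ> b = unit\<close>; this return to \<open>l\<close> lets associativity over
    \<open>act B l a\<close> be applied to \<open>b \<circ> (a \<circ> x)\<close>.\<close>
  have act_b: "act B (act B l a) b = l"
    using act_circ[OF l a b(1)] b l by simp
  show ?thesis
  proof (rule bij_betw_byWitness[where f' = "circ B (act B l a) b"])
    show "\<forall>x\<in>Carrier B. circ B (act B l a) b (circ B l a x) = x"
      using circ_assoc[of "act B l a" b a] l a b act_b by simp
    show "\<forall>x\<in>Carrier B. circ B l a (circ B (act B l a) b x) = x"
      using circ_assoc[of l a b] l a b by simp
  qed (use l a b in auto)
qed

lemma inver_circ:
  assumes "l \<in> \<Lambda>" "a \<in> Carrier B" "b \<in> Carrier B"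
  shows "inver l (circ B l a b) =
    dot B l (dot B l (inver l a) (circ B l a (inver (act B l a) b))) (inver l a)"
proof -
  \<comment> \<open>The brace axiom for \<open>b\<close> times its inverse over
    \<open>act B l a\<close>: the left side becomes \<open>a \<circ> unit = a\<close>. Right
    multiplication by \<open>inver l a\<close> then exhibits the inverse of
    \<open>a \<circ> b\<close>.\<close>
  have "dot B l (circ B l a b) (dot B l (inver l a) (circ B l a (inver (act B l a) b))) = a"
    using circ_mul[of l a b "inver (act B l a) b"] assms by simp
  then have "dot B l (circ B l a b)
      (dot B l (dot B l (inver l a) (circ B l a (inver (act B l a) b))) (inver l a)) = unit"
    using assms by (simp flip: assoc)
  then show ?thesis
    using assms by (intro inver_unique[symmetric]) auto
qed

lemma left_mul_bij:
  assumes "l \<in> \<Lambda>" "a \<in> Carrier B"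
  shows "bij_betw (dot B l a) (Carrier B) (Carrier B)"
  by (rule bij_betw_byWitness[where f' = "dot B l (inver l a)"]) (use assms in auto)

lemma post_group:
  "dynamical_post_group \<Lambda> (post_group_of_brace \<Lambda> B) \<and> action_compatible \<Lambda> (post_group_of_brace \<Lambda> B)"
proof -
  let ?P = "post_group_of_brace \<Lambda> B"
  have sel: "Carrier ?P = Carrier B" "act ?P = act B" "dot ?P = dot B"
    by (simp_all add: post_group_of_brace_def)
  have tri: "tri ?P l a b = dot B l (inver l a) (circ B l a b)"
    if "l \<in> \<Lambda>" "a \<in> Carrier B" "b \<in> Carrier B" for l a b
    using that by (simp add: post_group_of_brace_def)
  have "tri ?P \<in> \<Lambda> \<rightarrow>\<^sub>E Carrier B \<rightarrow>\<^sub>E Carrier B \<rightarrow>\<^sub>E Carrier B"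
    by (auto simp: post_group_of_brace_def)
  moreover have "dynamical_set \<Lambda> ?P"
    using brace by (simp add: dynamical_skew_brace_def dynamical_group_def dynamical_set_def sel)
  moreover have "bij_betw (tri ?P l a) (Carrier B) (Carrier B)"
    if "l \<in> \<Lambda>" "a \<in> Carrier B" for l a
    using bij_betw_trans[OF circ_bij left_mul_bij, of l a l "inver l a"] that
    by (subst bij_betw_cong[where g = "dot B l (inver l a) \<circ> circ B l a"]) (auto simp: tri)
  moreover have "tri ?P l a (dot B (act B l a) b c) = dot B l (tri ?P l a b) (tri ?P l a c)"
    if "l \<in> \<Lambda>" "a \<in> Carrier B" "b \<in> Carrier B" "c \<in> Carrier B" for l a b c
    using that by (simp add: tri circ_mul assoc)
  \<comment> \<open>As \<open>a \<cdot> (a \<rhd> b) = a \<circ> b\<close>, the left side is the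
    inverse of \<open>a \<circ> b\<close> times \<open>(a \<circ> b) \<circ> c\<close>. Expanding
    the right side by the brace axiom yields the prefix computed in \<open>inver_circ\<close>,
    followed by \<open>a \<circ> (b \<circ> c)\<close>.\<close>
  moreover have "tri ?P l (dot B l a (tri ?P l a b)) c = tri ?P l a (tri ?P (act B l a) b c)"
    if "l \<in> \<Lambda>" "a \<in> Carrier B" "b \<in> Carrier B" "c \<in> Carrier B" for l a b c
    using that by (simp add: tri circ_mul circ_assoc inver_circ assoc)
  ultimately have "dynamical_post_group \<Lambda> ?P"
    using constant_dynamical_group by (auto simp: dynamical_post_group_def sel)
  \<comment> \<open>After cancellation this is the compatibility of \<open>act\<close> with
    \<open>\<circ>\<close> in a dynamical group.\<close>
  moreover have "action_compatible \<Lambda> ?P"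
    by (auto simp: action_compatible_def sel tri act_circ)
  ultimately show ?thesis ..
qed

lemma brace_of_post_group_of_brace: "brace_of_post_group \<Lambda> (post_group_of_brace \<Lambda> B) = B"
proof -
  have "circ (brace_of_post_group \<Lambda> (post_group_of_brace \<Lambda> B)) = circ B"
    by (rule PiE3_eqI[OF _ circ_mem])
      (auto simp: post_group_of_brace_def brace_of_post_group_def)
  then show ?thesis
    by (intro dyn_skew_brace.equality) (simp_all add: post_group_of_brace_def brace_of_post_group_def)
qed

end

section \<open>Morphisms\<close>

lemma dyn_set_hom_mem:
  "f \<in> dyn_set_hom \<Lambda> X Y \<Longrightarrow> l \<in> \<Lambda> \<Longrightarrow> x \<in> Carrier X \<Longrightarrow> f l x \<in> Carrier Y"
  unfolding dyn_set_hom_def using PiE2_mem by blast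

lemma dyn_id_hom: "dynamical_set \<Lambda> X \<Longrightarrow> dyn_id \<Lambda> X \<in> dyn_set_hom \<Lambda> X X"
  by (auto simp: dyn_set_hom_def dyn_id_def)

lemma dyn_comp_hom:
  assumes "f \<in> dyn_set_hom \<Lambda> X Y" "g \<in> dyn_set_hom \<Lambda> Y Z"
  shows "dyn_comp \<Lambda> X g f \<in> dyn_set_hom \<Lambda> X Z"
  using assms dyn_set_hom_mem[OF assms(1)] dyn_set_hom_mem[OF assms(2)]
  by (auto simp: dyn_set_hom_def dyn_comp_def)

lemma dyn_comp_dyn_id:
  assumes "f \<in> dyn_set_hom \<Lambda> X Y"
  shows "dyn_comp \<Lambda> X f (dyn_id \<Lambda> X) = f" "dyn_comp \<Lambda> X (dyn_id \<Lambda> Y) f = f"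
proof -
  have f: "f \<in> \<Lambda> \<rightarrow>\<^sub>E Carrier X \<rightarrow>\<^sub>E Carrier Y"
    using assms by (simp add: dyn_set_hom_def)
  show "dyn_comp \<Lambda> X f (dyn_id \<Lambda> X) = f" "dyn_comp \<Lambda> X (dyn_id \<Lambda> Y) f = f"
    by (rule PiE2_eqI[OF _ f];
        use dyn_set_hom_mem[OF assms] in \<open>auto simp: dyn_comp_def dyn_id_def\<close>)+
qed

text \<open>The inner composite of \<open>h\<close> and \<open>g\<close> is restricted to
  \<open>Carrier X\<close>; \<open>f\<close> takes its values there, so the restriction is
  invisible.\<close>

lemma dyn_comp_assoc:
  assumes "f \<in> dyn_set_hom \<Lambda> W X"
  shows "dyn_comp \<Lambda> W (dyn_comp \<Lambda> X h g) f = dyn_comp \<Lambda> W h (dyn_comp \<Lambda> W g f)"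
  using dyn_set_hom_mem[OF assms] by (auto simp: dyn_comp_def fun_eq_iff restrict_def)

section \<open>The categories of dynamical post-groups and dynamical skew braces\<close>

lemma DPG_simps [simp]:
  "Obj (DPG \<Lambda>) = {P. dynamical_post_group \<Lambda> P \<and> action_compatible \<Lambda> P}"
  "Hom (DPG \<Lambda>) = post_group_hom \<Lambda>" "Ident (DPG \<Lambda>) = dyn_id \<Lambda>"
  "Comp (DPG \<Lambda>) X Y Z = dyn_comp \<Lambda> X"
  by (simp_all add: DPG_def)

lemma DSB_simps [simp]:
  "Obj (DSB \<Lambda>) = {B. dynamical_skew_brace \<Lambda> B}"
  "Hom (DSB \<Lambda>) = skew_brace_hom \<Lambda>" "Ident (DSB \<Lambda>) = dyn_id \<Lambda>"
  "Comp (DSB \<Lambda>) X Y Z = dyn_comp \<Lambda> X"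
  by (simp_all add: DSB_def)

lemma post_group_homD:
  assumes "f \<in> post_group_hom \<Lambda> P Q"
  shows "f \<in> dyn_set_hom \<Lambda> P Q"
    and "l \<in> \<Lambda> \<Longrightarrow> a \<in> Carrier P \<Longrightarrow> f l a \<in> Carrier Q"
    and "l \<in> \<Lambda> \<Longrightarrow> a \<in> Carrier P \<Longrightarrow> act Q l (f l a) = act P l a"
    and "l \<in> \<Lambda> \<Longrightarrow> a \<in> Carrier P \<Longrightarrow> b \<in> Carrier P \<Longrightarrow> f l (dot P l a b) = dot Q l (f l a) (f l b)"
    and "l \<in> \<Lambda> \<Longrightarrow> a \<in> Carrier P \<Longrightarrow> b \<in> Carrier P \<Longrightarrow>
      f l (tri P l a b) = tri Q l (f l a) (f (act P l a) b)"
  using assms dyn_set_hom_mem[of f \<Lambda> P Q] by (auto simp: post_group_hom_def dyn_set_hom_def)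

lemma skew_brace_homD:
  assumes "f \<in> skew_brace_hom \<Lambda> A B"
  shows "f \<in> dyn_set_hom \<Lambda> A B"
    and "l \<in> \<Lambda> \<Longrightarrow> a \<in> Carrier A \<Longrightarrow> f l a \<in> Carrier B"
    and "l \<in> \<Lambda> \<Longrightarrow> a \<in> Carrier A \<Longrightarrow> act B l (f l a) = act A l a"
    and "l \<in> \<Lambda> \<Longrightarrow> a \<in> Carrier A \<Longrightarrow> b \<in> Carrier A \<Longrightarrow> f l (dot A l a b) = dot B l (f l a) (f l b)"
    and "l \<in> \<Lambda> \<Longrightarrow> a \<in> Carrier A \<Longrightarrow> b \<in> Carrier A \<Longrightarrow>
      f l (circ A l a b) = circ B l (f l a) (f (act A l a) b)"
  using assms dyn_set_hom_mem[of f \<Lambda> A B] by (auto simp: skew_brace_hom_def dyn_set_hom_def)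

lemma post_group_hom_id:
  assumes "post_group \<Lambda> P"
  shows "dyn_id \<Lambda> P \<in> post_group_hom \<Lambda> P P"
proof -
  interpret post_group \<Lambda> P by fact
  have "dynamical_set \<Lambda> P"
    using post by (simp add: dynamical_post_group_def)
  then show ?thesis
    using dyn_id_hom[of \<Lambda> P] by (auto simp: post_group_hom_def dyn_id_def)
qed

lemma skew_brace_hom_id:
  assumes "skew_brace \<Lambda> B"
  shows "dyn_id \<Lambda> B \<in> skew_brace_hom \<Lambda> B B"
proof -
  interpret skew_brace \<Lambda> B by fact
  have "dynamical_set \<Lambda> B"
    using brace by (simp add: dynamical_skew_brace_def dynamical_group_def)
  then show ?thesis
    using dyn_id_hom[of \<Lambda> B] by (auto simp: skew_brace_hom_def dyn_id_def)
qed

text \<open>In the \<open>tri\<close> condition \<open>g\<close> is evaluated at the index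
  \<open>act Q l (f l a)\<close>; this equals \<open>act P l a\<close>, the index at which the
  composite is evaluated.\<close>

lemma post_group_hom_comp:
  assumes "post_group \<Lambda> P" and f: "f \<in> post_group_hom \<Lambda> P Q" and g: "g \<in> post_group_hom \<Lambda> Q R"
  shows "dyn_comp \<Lambda> P g f \<in> post_group_hom \<Lambda> P R"
proof -
  interpret post_group \<Lambda> P by fact
  show ?thesis
    using dyn_comp_hom[OF post_group_homD(1)[OF f] post_group_homD(1)[OF g]]
    by (simp add: post_group_hom_def)
      (simp add: dyn_comp_def post_group_homD(2-)[OF f] post_group_homD(2-)[OF g])
qed

lemma skew_brace_hom_comp:
  assumes "skew_brace \<Lambda> A" and f: "f \<in> skew_brace_hom \<Lambda> A B" and g: "g \<in> skew_brace_hom \<Lambda> B C"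
  shows "dyn_comp \<Lambda> A g f \<in> skew_brace_hom \<Lambda> A C"
proof -
  interpret skew_brace \<Lambda> A by fact
  show ?thesis
    using dyn_comp_hom[OF skew_brace_homD(1)[OF f] skew_brace_homD(1)[OF g]]
    by (simp add: skew_brace_hom_def)
      (simp add: dyn_comp_def skew_brace_homD(2-)[OF f] skew_brace_homD(2-)[OF g])
qed

lemma is_category_DPG: "is_category (DPG \<Lambda>)"
  unfolding is_category_def
  by (auto simp: post_group_hom_id post_group_hom_comp post_group_def
      dyn_comp_dyn_id[OF post_group_homD(1)] dyn_comp_assoc[OF post_group_homD(1)])

lemma is_category_DSB: "is_category (DSB \<Lambda>)"
  unfolding is_category_def
  by (auto simp: skew_brace_hom_id skew_brace_hom_comp skew_brace_def
      dyn_comp_dyn_id[OF skew_brace_homD(1)] dyn_comp_assoc[OF skew_brace_homD(1)])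

section \<open>The two functors and their composites\<close>

lemma skew_brace_hom_of_post_group_hom:
  assumes "post_group \<Lambda> P" and f: "f \<in> post_group_hom \<Lambda> P Q"
  shows "f \<in> skew_brace_hom \<Lambda> (brace_of_post_group \<Lambda> P) (brace_of_post_group \<Lambda> Q)"
proof -
  interpret post_group \<Lambda> P by fact
  show ?thesis
    using post_group_homD(1)[OF f]
    by (auto simp: skew_brace_hom_def brace_of_post_group_def dyn_set_hom_def
        post_group_homD(2-)[OF f])
qed

lemma post_group_hom_of_skew_brace_hom:
  assumes "skew_brace \<Lambda> A" "skew_brace \<Lambda> B" and f: "f \<in> skew_brace_hom \<Lambda> A B"
  shows "f \<in> post_group_hom \<Lambda> (post_group_of_brace \<Lambda> A) (post_group_of_brace \<Lambda> B)"
proof -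
  interpret A: skew_brace \<Lambda> A by fact
  interpret B: skew_brace \<Lambda> B by fact
  \<comment> \<open>Each component \<open>f l\<close> is a homomorphism of the groups at
    \<open>l\<close>. With this, \<open>f l\<close> can be pushed through both factors of
    \<open>inver l a \<cdot> (a \<circ> b)\<close>.\<close>
  have "f l (A.inver l a) = B.inver l (f l a)" if "l \<in> \<Lambda>" "a \<in> Carrier A" for l a
    by (rule group_family_hom_inver[OF A.group_family_axioms B.group_family_axioms that])
      (use that skew_brace_homD[OF f] in auto)
  then show ?thesis
    using skew_brace_homD(1)[OF f]
    by (auto simp: post_group_hom_def post_group_of_brace_def dyn_set_hom_def
        skew_brace_homD(2-)[OF f])
qed

text \<open>\<open>dyn_id\<close> and \<open>dyn_comp\<close> depend on an object only through its
  carrier, so these equations give preservation of identities and composites by both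
  functors.\<close>

lemma Carrier_brace_post_group:
  "Carrier (brace_of_post_group \<Lambda> P) = Carrier P" "Carrier (post_group_of_brace \<Lambda> B) = Carrier B"
  by (simp_all add: brace_of_post_group_def post_group_of_brace_def)

lemma is_functor_F: "is_functor (DPG \<Lambda>) (DSB \<Lambda>) (functor_F \<Lambda>)"
  by (auto simp: is_functor_def is_category_DPG is_category_DSB functor_F_def
      post_group.skew_brace post_group_def skew_brace_hom_of_post_group_hom
      dyn_id_def dyn_comp_def Carrier_brace_post_group)

lemma is_functor_G: "is_functor (DSB \<Lambda>) (DPG \<Lambda>) (functor_G \<Lambda>)"
  by (auto simp: is_functor_def is_category_DPG is_category_DSB functor_G_def
      skew_brace.post_group skew_brace_def post_group_hom_of_skew_brace_hom
      dyn_id_def dyn_comp_def Carrier_brace_post_group)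

lemma functors_agree_GF: "functors_agree (DPG \<Lambda>) (comp_functor (functor_G \<Lambda>) (functor_F \<Lambda>)) id_functor"
  by (auto simp: functors_agree_def comp_functor_def id_functor_def functor_F_def functor_G_def
      post_group.post_group_of_brace_of_post_group post_group_def)

lemma functors_agree_FG: "functors_agree (DSB \<Lambda>) (comp_functor (functor_F \<Lambda>) (functor_G \<Lambda>)) id_functor"
  by (auto simp: functors_agree_def comp_functor_def id_functor_def functor_F_def functor_G_def
      skew_brace.brace_of_post_group_of_brace skew_brace_def)

theorem theorem5p7:
  fixes \<Lambda> :: "'l set"
  defines "\<FF> \<equiv> (functor_F \<Lambda> ::
      (('l, 'a) dyn_post_group, 'l \<Rightarrow> 'a \<Rightarrow> 'a, ('l, 'a) dyn_skew_brace, 'l \<Rightarrow> 'a \<Rightarrow> 'a) category_map)"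
    and "\<GG> \<equiv> (functor_G \<Lambda> ::
      (('l, 'a) dyn_skew_brace, 'l \<Rightarrow> 'a \<Rightarrow> 'a, ('l, 'a) dyn_post_group, 'l \<Rightarrow> 'a \<Rightarrow> 'a) category_map)"
  shows "is_functor (DPG \<Lambda>) (DSB \<Lambda>) \<FF> \<and>
         is_functor (DSB \<Lambda>) (DPG \<Lambda>) \<GG> \<and>
         functors_agree (DPG \<Lambda>) (comp_functor \<GG> \<FF>) id_functor \<and>
         functors_agree (DSB \<Lambda>) (comp_functor \<FF> \<GG>) id_functor \<and>
         category_isomorphism (DPG \<Lambda>) (DSB \<Lambda>) \<FF>"
  unfolding \<FF>_def \<GG>_def category_isomorphism_def
  \<comment> \<open>The existential in \<open>category_isomorphism\<close> is witnessed by
    \<open>functor_G \<Lambda>\<close>.\<close>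
  using is_functor_F is_functor_G functors_agree_GF functors_agree_FG by blast

end
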